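(* The game $\mathcal{G}$ induced by the centralized mechanism described in the context has at least one (pure-strategy) Nash equilibrium.
   Context: Setting. There are $N\ge 2$ users $\mathcal{N}=\{1,\dots,N\}$ (user indices $i\pm1$ are taken modulo $N$) and $T\ge 1$ time slots. The prices $p_1,\dots,p_T\in\mathbb{R}$ and the peak price $p_0\ge 0$ are fixed. User $i$'s demand vector is $\boldsymbol{x}^i=(x^i_1,\dots,x^i_T)\in\mathbb{R}^T$, and $\boldsymbol{x}=(\boldsymbol{x}^1,\dots,\boldsymbol{x}^N)\in\mathbb{R}^{NT}$. User $i$'s utility is $v^i(\boldsymbol{x}^i)=\sum_{t=1}^T v^i_t(x^i_t)$, where each $v^i_t:\mathbb{R}\to\mathbb{R}$ is twice differentiable and strictly concave. The feasible set $\mathcal{X}=\{\boldsymbol{x}: A\boldsymbol{x}\le\boldsymbol{b}\}$, with $A\in\mathbb{R}^{L\times NT}$ and $\boldsymbol{b}=(b^1,\dots,b^L)\in\mathbb{R}^L_+$, is a (bounded) polytope and is coordinate convex: if $\boldsymbol{x}\in\mathcal{X}$, then setting any components of $\boldsymbol{x}$ to $0$ gives a point of $\mathcal{X}$. Row $l$ of $A$ has entries $a^{i,l}_t$; put $\boldsymbol{a}^{i,l}=[a^{i,l}_1,\dots,a^{i,l}_T]$ (row vector), so constraint $l$ is $\sum_i\boldsymbol{a}^{i,l}\boldsymbol{x}^i\le b^l$. Let $\mathcal{L}=\{1,\dots,L\}$ and $\mathcal{L}_i=\{l\in\mathcal{L}:\boldsymbol{a}^{i,l}\ne 0\}$. Centralized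 mechanism. User $i$'s message is $m^i=((y^i_t)_{t},(q^{i,l})_{l\in\mathcal{L}},(s^i_t)_{t},(\beta^i_t)_{t})$ with $y^i_t\in\mathbb{R}$, $q^{i,l}\in\mathbb{R}_+$, $s^i_t\in\mathbb{R}_+$, $\beta^i_t\in\mathbb{R}$; $m=(m^1,\dots,m^N)$. The allocation is $\hat x^i_t(m)=y^i_t$. The radial pricing operator is, for $\tilde{\boldsymbol{s}}\in\mathbb{R}^T_+$, $\tilde{\boldsymbol{y}}\in\mathbb{R}^T$, $$\mathcal{RP}^i_t(\tilde{\boldsymbol{s}},\tilde{\boldsymbol{y}})=\begin{cases}\dfrac{\tilde s_t}{\sum_{t'}\tilde s_{t'}}\,p_0,&\tilde{\boldsymbol{s}}\neq\boldsymbol{0},\\[2mm] \dfrac{p_0\,\mathbf{1}\{t\in\arg\max_{t'}\tilde y_{t'}\}}{\#(\arg\max_{t'}\tilde y_{t'})},&\tilde{\boldsymbol{s}}=\boldsymbol{0}\end{cases}$$ (the same formula for every $i$). Define $s^{-i}_t=\frac1{N-1}\sum_{j\ne i}s^j_t$, $q^{-i,l}=\frac1{N-1}\sum_{j\ne i}q^{j,l}$, $\zeta^{-i}_t=\sum_{j\neq i}y^j_t+\beta^{i-1}_t$, $z^{-i}=\max_t\zeta^{-i}_t$, with vectors $\boldsymbol{s}^{-i}=(s^{-i}_t)_t$, $\boldsymbol{\zeta}^{-i}=(\zeta^{-i}_t)_t$. The tax of user $i$ is $$\hat t^i(m)=\sum_{t=1}^T\big(p_t+\mathcal{RP}^i_t(\boldsymbol{s}^{-i},\boldsymbol{\zeta}^{-i})\big)\hat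 x^i_t(m)+\sum_{l\in\mathcal{L}_i}q^{-i,l}\boldsymbol{a}^{i,l}\hat{\boldsymbol{x}}^i(m)+\sum_{t=1}^T(\beta^i_t-y^{i+1}_t)^2$$ $$+\sum_{l\in\mathcal{L}}\Big[(q^{i,l}-q^{-i,l})^2+q^{i,l}\Big(b^l-\sum_{j\ne i}\boldsymbol{a}^{j,l}\boldsymbol{y}^j-\boldsymbol{a}^{i,l}\boldsymbol{\beta}^{i-1}\Big)\Big]+\sum_{t=1}^T\Big[(s^i_t-s^{-i}_t)^2+s^i_t(z^{-i}-\zeta^{-i}_t)\Big].$$ The induced game $\mathcal{G}$ has players $\mathcal{N}$, strategies $m^i$, and payoffs $u^i(m)=v^i(\hat{\boldsymbol{x}}^i(m))-\hat t^i(m)$. Nash equilibrium (NE) means pure-strategy Nash equilibrium. *)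

theory Defs
  imports "HOL-Analysis.Analysis"
begin

definition strictly_concave :: "(real \<Rightarrow> real) \<Rightarrow> bool" where
  "strictly_concave f \<longleftrightarrow>
     (\<forall>x y u. x \<noteq> y \<longrightarrow> 0 < u \<longrightarrow> u < 1 \<longrightarrow>
        (1 - u) * f x + u * f y < f ((1 - u) * x + u * y))"

definition twice_differentiable :: "(real \<Rightarrow> real) \<Rightarrow> bool" where
  "twice_differentiable f \<longleftrightarrow>
     (\<forall>x. f differentiable (at x)) \<and> (\<forall>x. deriv f differentiable (at x))"

definition nash_equilibrium ::
    "'i set \<Rightarrow> ('i \<Rightarrow> 's set) \<Rightarrow> ('i \<Rightarrow> ('i \<Rightarrow> 's) \<Rightarrow> real) \<Rightarrow> ('i \<Rightarrow> 's) \<Rightarrow> bool" where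
  "nash_equilibrium P S u m \<longleftrightarrow>
     (\<forall>i\<in>P. m i \<in> S i) \<and> (\<forall>i\<in>P. \<forall>d\<in>S i. u i (m(i := d)) \<le> u i m)"

text \<open>Users are the naturals \<open>1, \<dots>, N\<close>, time slots are the elements of the finite type \<open>'t\<close>
  and constraints those of the finite type \<open>'l\<close>.  A family indexed by users is a function on
  \<open>nat\<close>; its values outside \<open>{1..N}\<close> are never used.\<close>

definition users :: "nat \<Rightarrow> nat set" where
  "users N = {1..N}"

definition next_user :: "nat \<Rightarrow> nat \<Rightarrow> nat" where
  "next_user N i = (if i = N then 1 else i + 1)"

definition prev_user :: "nat \<Rightarrow> nat \<Rightarrow> nat" where
  "prev_user N i = (if i = 1 then N else i - 1)"

text \<open>The coefficient of \<open>x i $ t\<close> in constraint \<open>l\<close> is \<open>a i l $ t\<close>.\<close>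

definition feasible_set ::
    "nat \<Rightarrow> (nat \<Rightarrow> 'l \<Rightarrow> real^'t) \<Rightarrow> real^'l \<Rightarrow> (nat \<Rightarrow> real^'t) set" where
  "feasible_set N a b = {x. \<forall>l. (\<Sum>i\<in>users N. a i l \<bullet> x i) \<le> b $ l}"

text \<open>Boundedness of the set of user-indexed families \<open>(x 1, \<dots>, x N)\<close>, that is, in the maximum
  of the norms of these components only: other values of \<open>x\<close> are arbitrary.\<close>

definition bounded_demands :: "nat \<Rightarrow> (nat \<Rightarrow> real^'t) set \<Rightarrow> bool" where
  "bounded_demands N X \<longleftrightarrow> (\<exists>B. \<forall>x\<in>X. \<forall>i\<in>users N. norm (x i) \<le> B)"

definition coordinate_convex :: "(nat \<Rightarrow> real^'t) set \<Rightarrow> bool" where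
  "coordinate_convex X \<longleftrightarrow>
     (\<forall>x\<in>X. \<forall>Z :: (nat \<times> 't) set. (\<lambda>i. \<chi> t. if (i, t) \<in> Z then 0 else x i $ t) \<in> X)"

record ('t::finite, 'l::finite) message =
  msg_y :: "real^'t"
  msg_q :: "real^'l"
  msg_s :: "real^'t"
  msg_beta :: "real^'t"

definition messages :: "('t::finite, 'l::finite) message set" where
  "messages = {d. (\<forall>l. 0 \<le> msg_q d $ l) \<and> (\<forall>t. 0 \<le> msg_s d $ t)}"

definition argmax_slots :: "real^'t \<Rightarrow> 't set" where
  "argmax_slots y = {t. is_arg_max (\<lambda>t'. y $ t') (\<lambda>_. True) t}"

definition radial_pricing :: "real \<Rightarrow> real^'t \<Rightarrow> real^'t \<Rightarrow> 't \<Rightarrow> real" where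
  "radial_pricing p0 s y t =
     (if s \<noteq> 0 then s $ t / (\<Sum>t'\<in>UNIV. s $ t') * p0
      else p0 * (if t \<in> argmax_slots y then 1 else 0) / real (card (argmax_slots y)))"

definition allocation ::
    "nat \<Rightarrow> (nat \<Rightarrow> ('t::finite, 'l::finite) message) \<Rightarrow> real^'t" where
  "allocation i m = msg_y (m i)"

definition others_s ::
    "nat \<Rightarrow> nat \<Rightarrow> (nat \<Rightarrow> ('t::finite, 'l::finite) message) \<Rightarrow> real^'t" where
  "others_s N i m = (1 / (real N - 1)) *\<^sub>R (\<Sum>j\<in>users N - {i}. msg_s (m j))"

definition others_q ::
    "nat \<Rightarrow> nat \<Rightarrow> (nat \<Rightarrow> ('t::finite, 'l::finite) message) \<Rightarrow> real^'l" where
  "others_q N i m = (1 / (real N - 1)) *\<^sub>R (\<Sum>j\<in>users N - {i}. msg_q (m j))"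

definition others_zeta ::
    "nat \<Rightarrow> nat \<Rightarrow> (nat \<Rightarrow> ('t::finite, 'l::finite) message) \<Rightarrow> real^'t" where
  "others_zeta N i m = (\<Sum>j\<in>users N - {i}. msg_y (m j)) + msg_beta (m (prev_user N i))"

definition others_z ::
    "nat \<Rightarrow> nat \<Rightarrow> (nat \<Rightarrow> ('t::finite, 'l::finite) message) \<Rightarrow> real" where
  "others_z N i m = Max (range (\<lambda>t. others_zeta N i m $ t))"

definition user_constraints :: "(nat \<Rightarrow> 'l \<Rightarrow> real^'t) \<Rightarrow> nat \<Rightarrow> 'l set" where
  "user_constraints a i = {l. a i l \<noteq> 0}"

definition tax ::
    "nat \<Rightarrow> real^'t \<Rightarrow> real \<Rightarrow> (nat \<Rightarrow> 'l \<Rightarrow> real^'t) \<Rightarrow> real^'l \<Rightarrow>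
     nat \<Rightarrow> (nat \<Rightarrow> ('t::finite, 'l::finite) message) \<Rightarrow> real" where
  "tax N p p0 a b i m =
     (\<Sum>t\<in>UNIV. (p $ t + radial_pricing p0 (others_s N i m) (others_zeta N i m) t)
                 * allocation i m $ t)
   + (\<Sum>l\<in>user_constraints a i. others_q N i m $ l * (a i l \<bullet> allocation i m))
   + (\<Sum>t\<in>UNIV. (msg_beta (m i) $ t - msg_y (m (next_user N i)) $ t)\<^sup>2)
   + (\<Sum>l\<in>UNIV. (msg_q (m i) $ l - others_q N i m $ l)\<^sup>2
        + msg_q (m i) $ l
          * (b $ l - (\<Sum>j\<in>users N - {i}. a j l \<bullet> msg_y (m j))
             - a i l \<bullet> msg_beta (m (prev_user N i))))
   + (\<Sum>t\<in>UNIV. (msg_s (m i) $ t - others_s N i m $ t)\<^sup>2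
        + msg_s (m i) $ t * (others_z N i m - others_zeta N i m $ t))"

definition utility :: "(nat \<Rightarrow> 't \<Rightarrow> real \<Rightarrow> real) \<Rightarrow> nat \<Rightarrow> real^'t \<Rightarrow> real" where
  "utility v i x = (\<Sum>t\<in>UNIV. v i t (x $ t))"

definition payoff ::
    "nat \<Rightarrow> (nat \<Rightarrow> 't \<Rightarrow> real \<Rightarrow> real) \<Rightarrow> real^'t \<Rightarrow> real \<Rightarrow>
     (nat \<Rightarrow> 'l \<Rightarrow> real^'t) \<Rightarrow> real^'l \<Rightarrow>
     nat \<Rightarrow> (nat \<Rightarrow> ('t::finite, 'l::finite) message) \<Rightarrow> real" where
  "payoff N v p p0 a b i m = utility v i (allocation i m) - tax N p p0 a b i m"

end

theory Submission
  imports Defs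
begin

text \<open>Let \<open>x\<close> maximise the welfare \<open>\<Sum>\<^sub>i (v\<^sup>i(x\<^sup>i) - p \<bullet> x\<^sup>i) - p\<^sub>0 max\<^sub>t \<Sum>\<^sub>i x\<^sup>i\<^sub>t\<close> over the polytope.  Because all
  constraints are linear, Farkas' lemma applied to the first-order conditions yields multipliers
  \<open>\<kappa>\<close> of the constraints and \<open>\<mu>\<close> of the peak, with \<open>\<Sum>\<^sub>t \<mu>\<^sub>t = p\<^sub>0\<close>.  If every user announces
  \<open>y\<^sup>i = x\<^sup>i\<close>, \<open>q\<^sup>i = \<kappa>\<close>, \<open>s\<^sup>i = \<mu>\<close>, \<open>\<beta>\<^sup>i = x\<^sup>i\<^sup>+\<^sup>1\<close>, then the price user \<open>i\<close> faces is exactly the marginal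
  utility at \<open>x\<^sup>i\<close>, and complementary slackness makes the penalty terms vanish, so nobody gains by
  deviating.\<close>

section \<open>Farkas' lemma by separation from a finitely generated cone\<close>

text \<open>The index set of the variables is an arbitrary finite set rather than a type, so the
  separation takes place in the space of constraint values: the vectors \<open>(z, w)\<close> such that some \<open>d\<close>
  has constraint values at most \<open>z\<close> and objective at least \<open>w\<close>.\<close>
lemma farkas_active:
  fixes c :: "'j \<Rightarrow> real^'k" and g :: "'j \<Rightarrow> real"
  assumes "finite J"
    and cone: "\<And>d. (\<And>k. k \<in> K \<Longrightarrow> (\<Sum>j\<in>J. d j * c j $ k) \<le> 0) \<Longrightarrow> (\<Sum>j\<in>J. d j * g j) \<le> 0"
  obtains y where "\<And>k. 0 \<le> y $ k" "\<And>k. k \<notin> K \<Longrightarrow> y $ k = 0" "\<And>j. j \<in> J \<Longrightarrow> g j = y \<bullet> c j"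
proof -
  \<comment> \<open>Generators: the image of each variable with both signs, positive slack for every
    constraint, and negative slack only outside \<open>K\<close>. There are finitely many, so their
    conic hull is closed.\<close>
  define S where "S = (\<lambda>j. (c j, g j)) ` J \<union> (\<lambda>j. - (c j, g j)) ` J
    \<union> range (\<lambda>k. (axis k 1, 0)) \<union> (\<lambda>k. - (axis k 1, 0)) ` (- K)"
  define W where "W = {z. \<exists>d. (\<forall>k\<in>K. (\<Sum>j\<in>J. d j * c j $ k) \<le> fst z $ k) \<and>
    snd z \<le> (\<Sum>j\<in>J. d j * g j)}"
  have "S \<subseteq> W"
  proof -
    have "(c j, g j) \<in> W" if "j \<in> J" for j
      unfolding W_def using that \<open>finite J\<close>
      by (intro CollectI exI[of _ "\<lambda>i. if i = j then 1 else 0"])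
        (simp add: if_distrib[of "\<lambda>u. u * _"] cong: if_cong)
    moreover have "- (c j, g j) \<in> W" if "j \<in> J" for j
      unfolding W_def using that \<open>finite J\<close>
      by (intro CollectI exI[of _ "\<lambda>i. if i = j then - 1 else 0"])
        (simp add: if_distrib[of "\<lambda>u. u * _"] cong: if_cong)
    moreover have "(axis k 1, 0) \<in> W" for k
      unfolding W_def by (intro CollectI exI[of _ "\<lambda>_. 0"]) (simp add: axis_def)
    moreover have "- (axis k 1, 0) \<in> W" if "k \<notin> K" for k
      unfolding W_def using that by (intro CollectI exI[of _ "\<lambda>_. 0"]) (auto simp: axis_def)
    ultimately show ?thesis unfolding S_def by auto
  qed
  moreover have "convex_cone W"
    unfolding convex_cone_iff
  proof (intro conjI ballI allI impI)
    show "0 \<in> W"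
      unfolding W_def by (intro CollectI exI[of _ "\<lambda>_. 0"]) simp
  next
    fix z w assume "z \<in> W" "w \<in> W"
    then obtain d e where "\<forall>k\<in>K. (\<Sum>j\<in>J. d j * c j $ k) \<le> fst z $ k" "snd z \<le> (\<Sum>j\<in>J. d j * g j)"
      "\<forall>k\<in>K. (\<Sum>j\<in>J. e j * c j $ k) \<le> fst w $ k" "snd w \<le> (\<Sum>j\<in>J. e j * g j)"
      unfolding W_def by blast
    then show "z + w \<in> W"
      unfolding W_def
      by (intro CollectI exI[of _ "\<lambda>j. d j + e j"]) (simp add: distrib_right sum.distrib add_mono)
  next
    fix z r assume "z \<in> W" "(0::real) \<le> r"
    then obtain d where "\<forall>k\<in>K. (\<Sum>j\<in>J. d j * c j $ k) \<le> fst z $ k" "snd z \<le> (\<Sum>j\<in>J. d j * g j)"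
      unfolding W_def by blast
    with \<open>0 \<le> r\<close> show "r *\<^sub>R z \<in> W"
      unfolding W_def
      by (intro CollectI exI[of _ "\<lambda>j. r * d j"])
        (simp add: mult.assoc sum_distrib_left[symmetric] mult_left_mono)
  qed
  ultimately have hull_W: "convex_cone hull S \<subseteq> W"
    by (simp add: hull_minimal)
  \<comment> \<open>A direction witnessing membership would respect all constraints in
    \<open>K\<close> and still have objective at least 1, against \<open>cone\<close>.\<close>
  have "(0, 1) \<notin> W"
    unfolding W_def using cone by fastforce
  with hull_W have "(0, 1) \<notin> convex_cone hull S"
    by blast
  moreover have "closed (convex_cone hull S)"
    using \<open>finite J\<close> unfolding S_def by (intro closed_convex_cone_hull) simp
  ultimately obtain n \<beta> where sep: "n \<bullet> (0, 1) < \<beta>" "\<And>z. z \<in> convex_cone hull S \<Longrightarrow> \<beta> < n \<bullet> z"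
    using separating_hyperplane_closed_point[OF convex_convex_cone_hull, of S "(0, 1)"] by blast
  have "\<beta> < 0"
    using sep(2)[OF convex_cone_hull_contains_0] by simp
  \<comment> \<open>On a cone the lower bound improves to 0: a generator with a negative value could
    be scaled until its value is exactly \<open>\<beta>\<close>, which strict separation
    excludes.\<close>
  have nonneg: "0 \<le> n \<bullet> z" if "z \<in> S" for z
  proof (rule ccontr)
    assume neg: "\<not> 0 \<le> n \<bullet> z"
    with \<open>\<beta> < 0\<close> have "(\<beta> / (n \<bullet> z)) *\<^sub>R z \<in> convex_cone hull S"
      by (intro convex_cone_hull_mul hull_inc[OF that]) (simp add: divide_nonpos_nonpos)
    from sep(2)[OF this] neg show False by simp
  qed
  obtain \<alpha> \<rho> where n: "n = (\<alpha>, \<rho>)" by (cases n)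
  have "\<rho> < 0" using sep(1) \<open>\<beta> < 0\<close> n by simp
  \<comment> \<open>Both signs of \<open>(c j, g j)\<close> are generators, so the inequality
    becomes an equality; the same happens below to the axes outside \<open>K\<close>.\<close>
  have c: "\<alpha> \<bullet> c j + \<rho> * g j = 0" if "j \<in> J" for j
    using nonneg[of "(c j, g j)"] nonneg[of "- (c j, g j)"] that
    unfolding S_def n by fastforce
  have pos: "0 \<le> \<alpha> $ k" for k
    using nonneg[of "(axis k 1, 0)"] unfolding S_def n by (simp add: inner_axis)
  have zero: "\<alpha> $ k = 0" if "k \<notin> K" for k
    using nonneg[of "- (axis k 1, 0)"] pos[of k] that unfolding S_def n by (simp add: inner_axis)
  \<comment> \<open>Dividing by \<open>- \<rho>\<close>, which is positive, normalises the weight of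
    the objective.\<close>
  show thesis
  proof (rule that[of "(1 / - \<rho>) *\<^sub>R \<alpha>"])
    fix j assume "j \<in> J"
    from c[OF this] \<open>\<rho> < 0\<close> show "g j = ((1 / - \<rho>) *\<^sub>R \<alpha>) \<bullet> c j"
      by (simp add: field_simps)
  qed (use pos zero \<open>\<rho> < 0\<close> in \<open>auto simp: divide_nonneg_neg\<close>)
qed

section \<open>Compactness and one-sided calculus\<close>

text \<open>Tychonoff's theorem, carried over to the type of all functions; demand families are
  functions on \<open>nat\<close>.\<close>

lemma compact_product:
  fixes C :: "'i \<Rightarrow> 'a::topological_space set"
  assumes "\<And>i. compact (C i)"
  shows "compact {x. \<forall>i. x i \<in> C i}"
proof -
  have "{x. \<forall>i. x i \<in> C i} = PiE UNIV C"
    by (auto simp: PiE_def)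
  then show ?thesis
    using assms compactin_PiE[of "\<lambda>_. euclidean" UNIV C]
    by (simp add: euclidean_product_topology)
qed

lemma continuous_on_Max_image:
  fixes f :: "'a \<Rightarrow> 'b::topological_space \<Rightarrow> real"
  assumes "finite I" "I \<noteq> {}" "\<And>i. i \<in> I \<Longrightarrow> continuous_on S (f i)"
  shows "continuous_on S (\<lambda>x. Max ((\<lambda>i. f i x) ` I))"
  using assms
proof (induction I rule: finite_ne_induct)
  case (insert i I)
  then have "continuous_on S (\<lambda>x. max (f i x) (Max ((\<lambda>i. f i x) ` I)))"
    by (intro continuous_on_max) auto
  with insert show ?case by simp
qed simp

text \<open>A slack constraint survives small steps by continuity, an active one because its value
  does not increase. Hence only active constraints restrict directions.\<close>

lemma eventually_active_le:
  fixes r c e :: real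
  assumes "r \<le> c" "r = c \<Longrightarrow> e \<le> 0"
  shows "\<forall>\<^sub>F \<eta> in at_right 0. r + \<eta> * e \<le> c"
proof (cases "r = c")
  case True
  with assms(2) show ?thesis
    unfolding eventually_at_filter by (auto intro!: always_eventually simp: mult_nonneg_nonpos)
next
  case False
  have "((\<lambda>\<eta>. r + \<eta> * e) \<longlongrightarrow> r + 0 * e) (at_right 0)"
    by (intro tendsto_intros)
  with False assms(1) have "\<forall>\<^sub>F \<eta> in at_right 0. r + \<eta> * e < c"
    by (intro order_tendstoD(2)) auto
  then show ?thesis by eventually_elim simp
qed

lemma deriv_nonpos_of_right_max:
  fixes f :: "real \<Rightarrow> real"
  assumes "DERIV f 0 :> D" "\<forall>\<^sub>F \<eta> in at_right 0. f \<eta> \<le> f 0"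
  shows "D \<le> 0"
proof (rule ccontr)
  assume "\<not> D \<le> 0"
  with DERIV_pos_inc_right[OF assms(1)] obtain d where d: "d > 0" "\<And>h. 0 < h \<Longrightarrow> h < d \<Longrightarrow> f 0 < f h"
    by auto
  have "\<forall>\<^sub>F \<eta> in at_right 0. \<eta> \<in> {0<..<d}"
    using d(1) by (rule eventually_at_right_real)
  with assms(2) have "\<forall>\<^sub>F \<eta> in at_right (0::real). False"
    by eventually_elim (use d(2) in force)
  then show False by simp
qed

text \<open>\<open>- f\<close> is convex and so lies above its tangents. This turns stationarity of
  a user's demand into global optimality.\<close>

lemma strictly_concave_le_tangent:
  assumes "strictly_concave f" "DERIV f x :> D"
  shows "f y \<le> f x + D * (y - x)"
proof -
  have "convex_on UNIV (\<lambda>x. - f x)"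
  proof (rule convex_onI)
    fix u x y :: real assume "0 < u" "u < 1"
    then show "- f ((1 - u) *\<^sub>R x + u *\<^sub>R y) \<le> (1 - u) * - f x + u * - f y"
      using assms(1) unfolding strictly_concave_def
      by (cases "x = y") (force simp: algebra_simps)+
  qed simp
  moreover have "((\<lambda>x. - f x) has_real_derivative - D) (at x within UNIV)"
    using assms(2) by (auto intro: derivative_intros)
  ultimately show ?thesis
    using convex_on_imp_above_tangent[of UNIV "\<lambda>x. - f x" x y "- D"]
    by (simp add: algebra_simps)
qed

section \<open>Cyclic neighbours and averages over the other users\<close>

lemma finite_users [simp]: "finite (users N)"
  by (simp add: users_def)

lemma next_prev_user: "i \<in> users N \<Longrightarrow> next_user N (prev_user N i) = i"
  by (auto simp: users_def prev_user_def next_user_def)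

lemma prev_user_neq: "2 \<le> N \<Longrightarrow> i \<in> users N \<Longrightarrow> prev_user N i \<noteq> i"
  by (auto simp: users_def prev_user_def)

lemma next_user_neq: "2 \<le> N \<Longrightarrow> i \<in> users N \<Longrightarrow> next_user N i \<noteq> i"
  by (auto simp: users_def next_user_def)

lemma average_const:
  fixes c :: "'a::real_vector"
  assumes "2 \<le> N" "i \<in> users N"
  shows "(1 / (real N - 1)) *\<^sub>R (\<Sum>j\<in>users N - {i}. c) = c"
proof -
  have "real (card (users N - {i})) = real N - 1"
    using assms by (simp add: users_def card_Diff_singleton of_nat_diff)
  then show ?thesis
    using assms by (simp add: sum_constant_scaleR)
qed

section \<open>From multipliers to an equilibrium\<close>

definition kkt_messages ::
    "nat \<Rightarrow> (nat \<Rightarrow> real^'t) \<Rightarrow> real^'l \<Rightarrow> real^'t \<Rightarrow> nat \<Rightarrow> ('t::finite, 'l::finite) message" where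
  "kkt_messages N x \<kappa> \<mu> i =
     \<lparr>msg_y = x i, msg_q = \<kappa>, msg_s = \<mu>, msg_beta = x (next_user N i)\<rparr>"

text \<open>Since \<open>\<beta>\<^sup>i\<^sup>-\<^sup>1 = x\<^sup>i\<close>, user \<open>i\<close> sees the total demand in \<open>\<zeta>\<^sup>-\<^sup>i\<close> and faces prices that
  his own message cannot influence, so the payoff separates into the four message components.\<close>
lemma payoff_deviation:
  fixes a :: "nat \<Rightarrow> 'l::finite \<Rightarrow> real^'t::finite" and x :: "nat \<Rightarrow> real^'t"
  assumes "2 \<le> N" "i \<in> users N" and \<mu>: "\<And>t. 0 \<le> \<mu> $ t" and p0: "(\<Sum>t\<in>UNIV. \<mu> $ t) = p0"
  defines "X \<equiv> \<Sum>j\<in>users N. x j"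
  shows "payoff N v p p0 a b i ((kkt_messages N x \<kappa> \<mu>)(i := d)) =
      (\<Sum>t\<in>UNIV. v i t (msg_y d $ t)
         - (p $ t + \<mu> $ t + (\<Sum>l\<in>UNIV. \<kappa> $ l * a i l $ t)) * msg_y d $ t)
    - (\<Sum>t\<in>UNIV. (msg_beta d $ t - x (next_user N i) $ t)\<^sup>2)
    - (\<Sum>l\<in>UNIV. (msg_q d $ l - \<kappa> $ l)\<^sup>2
         + msg_q d $ l * (b $ l - (\<Sum>j\<in>users N. a j l \<bullet> x j)))
    - (\<Sum>t\<in>UNIV. (msg_s d $ t - \<mu> $ t)\<^sup>2
         + msg_s d $ t * (Max (range (($) X)) - X $ t))"
proof -
  let ?m = "(kkt_messages N x \<kappa> \<mu>)(i := d)"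
  note neq = prev_user_neq[OF assms(1,2)] next_user_neq[OF assms(1,2)]
  have s: "others_s N i ?m = \<mu>"
    using average_const[OF assms(1,2), of \<mu>] by (simp add: others_s_def kkt_messages_def)
  have q: "others_q N i ?m = \<kappa>"
    using average_const[OF assms(1,2), of \<kappa>] by (simp add: others_q_def kkt_messages_def)
  have zeta: "others_zeta N i ?m = X"
    using assms(2) neq unfolding X_def
    by (simp add: others_zeta_def kkt_messages_def next_prev_user sum.remove[of _ i] add.commute)
  \<comment> \<open>If \<open>\<mu> = 0\<close>, then \<open>p0 = 0\<close> and the argmax branch
    charges nothing; otherwise the normalising sum is \<open>p0\<close> itself and cancels.\<close>
  have price: "radial_pricing p0 \<mu> X t = \<mu> $ t" for t
  proof (cases "\<mu> = 0")
    case True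
    with p0 show ?thesis by (auto simp: radial_pricing_def)
  next
    case False
    then obtain t' where "\<mu> $ t' \<noteq> 0" by (metis vec_eq_iff zero_index)
    with \<mu> have "p0 \<noteq> 0"
      using sum_nonneg_eq_0_iff[of UNIV "($) \<mu>"] p0 by auto
    with False p0 show ?thesis by (simp add: radial_pricing_def)
  qed
  have shadow: "(\<Sum>l\<in>user_constraints a i. \<kappa> $ l * (a i l \<bullet> y))
      = (\<Sum>t\<in>UNIV. (\<Sum>l\<in>UNIV. \<kappa> $ l * a i l $ t) * y $ t)" for y
  proof -
    have "(\<Sum>l\<in>user_constraints a i. \<kappa> $ l * (a i l \<bullet> y)) = (\<Sum>l\<in>UNIV. \<kappa> $ l * (a i l \<bullet> y))"
      by (rule sum.mono_neutral_left) (auto simp: user_constraints_def)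
    also have "\<dots> = (\<Sum>l\<in>UNIV. \<Sum>t\<in>UNIV. \<kappa> $ l * a i l $ t * y $ t)"
      by (simp add: inner_vec_def sum_distrib_left mult.assoc)
    also have "\<dots> = (\<Sum>t\<in>UNIV. (\<Sum>l\<in>UNIV. \<kappa> $ l * a i l $ t) * y $ t)"
      by (subst sum.swap) (simp add: sum_distrib_right)
    finally show ?thesis .
  qed
  have load: "(\<Sum>j\<in>users N - {i}. a j l \<bullet> msg_y (?m j)) + a i l \<bullet> msg_beta (?m (prev_user N i))
      = (\<Sum>j\<in>users N. a j l \<bullet> x j)" for l
    using assms(2) neq
    by (simp add: kkt_messages_def next_prev_user sum.remove[of _ i] add.commute)
  have residual: "b $ l - (\<Sum>j\<in>users N - {i}. a j l \<bullet> msg_y (?m j)) - a i l \<bullet> msg_beta (?m (prev_user N i))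
      = b $ l - (\<Sum>j\<in>users N. a j l \<bullet> x j)" for l
    using load[of l] by linarith
  have succ: "msg_y (?m (next_user N i)) = x (next_user N i)"
    using neq by (simp add: kkt_messages_def)
  show ?thesis
    unfolding payoff_def tax_def utility_def allocation_def others_z_def s q zeta price shadow
      residual succ
    by (simp add: sum_subtractf distrib_right sum.distrib)
qed

text \<open>Every penalty sum is nonnegative for an admissible message, and at the candidate it
  vanishes, by construction or by slackness. What remains separates over the time slots, where
  \<open>optimal\<close> applies.\<close>

lemma nash_equilibrium_kkt_messages:
  fixes a :: "nat \<Rightarrow> 'l::finite \<Rightarrow> real^'t::finite" and x :: "nat \<Rightarrow> real^'t"
  assumes "2 \<le> N" and \<kappa>: "\<And>l. 0 \<le> \<kappa> $ l" and \<mu>: "\<And>t. 0 \<le> \<mu> $ t"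
    and p0: "(\<Sum>t\<in>UNIV. \<mu> $ t) = p0"
    and feasible: "x \<in> feasible_set N a b"
    and slack_\<kappa>: "\<And>l. \<kappa> $ l * (b $ l - (\<Sum>j\<in>users N. a j l \<bullet> x j)) = 0"
    and slack_\<mu>: "\<And>t. \<mu> $ t * (Max (range (($) (\<Sum>j\<in>users N. x j))) - (\<Sum>j\<in>users N. x j) $ t) = 0"
    and optimal: "\<And>i t y. i \<in> users N \<Longrightarrow>
      v i t y - (p $ t + \<mu> $ t + (\<Sum>l\<in>UNIV. \<kappa> $ l * a i l $ t)) * y
      \<le> v i t (x i $ t) - (p $ t + \<mu> $ t + (\<Sum>l\<in>UNIV. \<kappa> $ l * a i l $ t)) * x i $ t"
  shows "nash_equilibrium (users N) (\<lambda>_. messages) (payoff N v p p0 a b) (kkt_messages N x \<kappa> \<mu>)"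
  unfolding nash_equilibrium_def
proof (intro conjI ballI)
  fix i assume i: "i \<in> users N"
  show "kkt_messages N x \<kappa> \<mu> i \<in> messages"
    using \<kappa> \<mu> by (simp add: messages_def kkt_messages_def)
  fix d :: "('t, 'l) message" assume d: "d \<in> messages"
  let ?m = "kkt_messages N x \<kappa> \<mu>"
  let ?X = "\<Sum>j\<in>users N. x j"
  let ?c = "\<lambda>t. p $ t + \<mu> $ t + (\<Sum>l\<in>UNIV. \<kappa> $ l * a i l $ t)"
  note payoff = payoff_deviation[where v = v and p = p and a = a and b = b and x = x and \<kappa> = \<kappa>,
      OF \<open>2 \<le> N\<close> i \<mu> p0]
  have "0 \<le> (\<Sum>l\<in>UNIV. (msg_q d $ l - \<kappa> $ l)\<^sup>2
      + msg_q d $ l * (b $ l - (\<Sum>j\<in>users N. a j l \<bullet> x j)))"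
    using d feasible by (intro sum_nonneg) (simp add: messages_def feasible_set_def)
  moreover have "0 \<le> (\<Sum>t\<in>UNIV. (msg_s d $ t - \<mu> $ t)\<^sup>2
      + msg_s d $ t * (Max (range (($) ?X)) - ?X $ t))"
    using d by (intro sum_nonneg add_nonneg_nonneg mult_nonneg_nonneg)
      (simp_all add: messages_def del: sum_component)
  moreover have "0 \<le> (\<Sum>t\<in>UNIV. (msg_beta d $ t - x (next_user N i) $ t)\<^sup>2)"
    by (intro sum_nonneg) simp
  moreover have "(\<Sum>t\<in>UNIV. v i t (msg_y d $ t) - ?c t * msg_y d $ t)
      \<le> (\<Sum>t\<in>UNIV. v i t (x i $ t) - ?c t * x i $ t)"
    by (intro sum_mono optimal i)
  ultimately have "payoff N v p p0 a b i (?m(i := d)) \<le> (\<Sum>t\<in>UNIV. v i t (x i $ t) - ?c t * x i $ t)"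
    unfolding payoff by linarith
  \<comment> \<open>Viewed as a trivial deviation, the candidate itself is evaluated by the same
    formula.\<close>
  also have "\<dots> = payoff N v p p0 a b i (?m(i := ?m i))"
    unfolding payoff kkt_messages_def
    by (simp add: slack_\<kappa> slack_\<mu> del: sum_component mult_eq_0_iff)
  finally show "payoff N v p p0 a b i (?m(i := d)) \<le> payoff N v p p0 a b i ?m"
    by simp
qed

section \<open>Existence of a welfare maximiser\<close>

definition welfare ::
    "nat \<Rightarrow> (nat \<Rightarrow> 't::finite \<Rightarrow> real \<Rightarrow> real) \<Rightarrow> real^'t \<Rightarrow> real \<Rightarrow> (nat \<Rightarrow> real^'t) \<Rightarrow> real" where
  "welfare N v p p0 x = (\<Sum>i\<in>users N. \<Sum>t\<in>UNIV. v i t (x i $ t) - p $ t * x i $ t)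
    - p0 * Max (range (\<lambda>t. \<Sum>i\<in>users N. x i $ t))"

text \<open>Weierstrass' theorem on the slice where the coordinates of non-users are 0; the whole
  feasible set is not compact in the product topology.\<close>

lemma ex_maximal_demand:
  fixes v :: "nat \<Rightarrow> 't::finite \<Rightarrow> real \<Rightarrow> real" and a :: "nat \<Rightarrow> 'l::finite \<Rightarrow> real^'t"
  assumes v: "\<And>i t. i \<in> users N \<Longrightarrow> continuous_on UNIV (v i t)"
    and b: "\<And>l. 0 \<le> b $ l"
    and bounded: "bounded_demands N (feasible_set N a b)"
  obtains x where "x \<in> feasible_set N a b"
    "\<And>y. y \<in> feasible_set N a b \<Longrightarrow> welfare N v p p0 y \<le> welfare N v p p0 x"
proof -
  let ?F = "feasible_set N a b"
  obtain B where B: "\<And>x i. x \<in> ?F \<Longrightarrow> i \<in> users N \<Longrightarrow> norm (x i) \<le> B"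
    using bounded unfolding bounded_demands_def by blast
  define C :: "nat \<Rightarrow> (real^'t) set" where "C i = (if i \<in> users N then cball 0 B else {0})" for i
  have coord: "continuous_on S (\<lambda>x. x i $ t)" for S :: "(nat \<Rightarrow> real^'t) set" and i t
    by (intro continuous_intros continuous_on_subset[OF continuous_on_product_coordinates]) simp
  have "compact {x. \<forall>i. x i \<in> C i}"
    by (rule compact_product) (simp add: C_def)
  moreover have "closed ?F"
  proof -
    have "?F = (\<Inter>l. {x. (\<Sum>i\<in>users N. \<Sum>t\<in>UNIV. a i l $ t * x i $ t) \<le> b $ l})"
      by (auto simp: feasible_set_def inner_vec_def)
    moreover have "closed \<dots>"
      by (intro closed_INT ballI closed_Collect_le continuous_intros coord)
    ultimately show ?thesis by simp
  qed
  ultimately have "compact ({x. \<forall>i. x i \<in> C i} \<inter> ?F)"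
    by (rule compact_Int_closed)
  \<comment> \<open>Zero demand is feasible because \<open>b\<close> is nonnegative, and the bound
    on its norm at a user gives \<open>0 \<le> B\<close>, so it lies in the balls.\<close>
  moreover have "(\<lambda>_. 0) \<in> {x. \<forall>i. x i \<in> C i} \<inter> ?F"
    using B[of "\<lambda>_. 0"] b by (auto simp: C_def feasible_set_def)
  moreover have "continuous_on ({x. \<forall>i. x i \<in> C i} \<inter> ?F) (welfare N v p p0)"
    unfolding welfare_def
    by (intro continuous_intros continuous_on_Max_image coord continuous_on_compose2[OF v]) auto
  ultimately obtain x where x: "x \<in> ?F"
    and max: "\<And>y. y \<in> {x. \<forall>i. x i \<in> C i} \<inter> ?F \<Longrightarrow> welfare N v p p0 y \<le> welfare N v p p0 x"
    using continuous_attains_sup[of "{x. \<forall>i. x i \<in> C i} \<inter> ?F" "welfare N v p p0"] by blast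
  show thesis
  proof (rule that[OF x])
    fix y assume y: "y \<in> ?F"
    \<comment> \<open>the coordinates of indices that are not users are unconstrained in the feasible set\<close>
    define y' where "y' i = (if i \<in> users N then y i else 0)" for i
    have "y' \<in> {x. \<forall>i. x i \<in> C i} \<inter> ?F"
      using B[OF y] y by (auto simp: y'_def C_def feasible_set_def)
    from max[OF this] show "welfare N v p p0 y \<le> welfare N v p p0 x"
      by (simp add: welfare_def y'_def)
  qed
qed

section \<open>Multipliers from the first-order conditions\<close>

text \<open>Small steps along a direction that respects the active linear constraints stay feasible,
  so welfare cannot grow to first order; \<open>farkas_active\<close> turns this into multipliers.
  An extra variable bounding the peak makes the nonsmooth maximum linear.\<close>

lemma ex_kkt_multipliers:
  fixes v :: "nat \<Rightarrow> 't::finite \<Rightarrow> real \<Rightarrow> real" and a :: "nat \<Rightarrow> 'l::finite \<Rightarrow> real^'t"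
  assumes v: "\<And>i t. i \<in> users N \<Longrightarrow> DERIV (v i t) (x i $ t) :> v' i t" and "0 \<le> p0"
    and x: "x \<in> feasible_set N a b"
    and max: "\<And>y. y \<in> feasible_set N a b \<Longrightarrow> welfare N v p p0 y \<le> welfare N v p p0 x"
  obtains \<kappa> :: "real^'l" and \<mu> :: "real^'t"
  where "\<And>l. 0 \<le> \<kappa> $ l" "\<And>t. 0 \<le> \<mu> $ t" "(\<Sum>t\<in>UNIV. \<mu> $ t) = p0"
    and "\<And>l. \<kappa> $ l * (b $ l - (\<Sum>j\<in>users N. a j l \<bullet> x j)) = 0"
    and "\<And>t. \<mu> $ t * (Max (range (($) (\<Sum>j\<in>users N. x j))) - (\<Sum>j\<in>users N. x j) $ t) = 0"
    and "\<And>i t. i \<in> users N \<Longrightarrow> v' i t = p $ t + \<mu> $ t + (\<Sum>l\<in>UNIV. \<kappa> $ l * a i l $ t)"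
proof -
  define X where "X t = (\<Sum>i\<in>users N. x i $ t)" for t
  define w where "w = Max (range X)"
  have X_le: "X t \<le> w" for t
    unfolding w_def by simp
  \<comment> \<open>Linearised problem: the variable \<open>Some (i, t)\<close> moves \<open>x i $ t\<close>, and \<open>None\<close> moves a bound on the
    peak demand, of marginal cost \<open>p0\<close>.\<close>
  define J where "J = insert None (Some ` (users N \<times> (UNIV :: 't set)))"
  \<comment> \<open>The entry \<open>- 1\<close> makes row \<open>Inr t\<close> the change of total
    demand in slot \<open>t\<close> minus the change of the peak bound.\<close>
  define c :: "(nat \<times> 't) option \<Rightarrow> real^('l + 't)" where
    "c j = (\<chi> k. case j of
        None \<Rightarrow> (case k of Inl l \<Rightarrow> 0 | Inr t' \<Rightarrow> - 1)
      | Some (i, t) \<Rightarrow> (case k of Inl l \<Rightarrow> a i l $ t | Inr t' \<Rightarrow> if t' = t then 1 else 0))" for j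
  define g where "g j = (case j of None \<Rightarrow> - p0 | Some (i, t) \<Rightarrow> v' i t - p $ t)" for j
  \<comment> \<open>The rows tight at \<open>x\<close>. That multipliers vanish outside
    \<open>K\<close> is complementary slackness.\<close>
  define K where "K = {k. case k of
      Inl l \<Rightarrow> (\<Sum>i\<in>users N. a i l \<bullet> x i) = b $ l | Inr t \<Rightarrow> X t = w}"
  have sum_J: "(\<Sum>j\<in>J. f j) = f None + (\<Sum>i\<in>users N. \<Sum>t\<in>UNIV. f (Some (i, t)))"
    for f :: "(nat \<times> 't) option \<Rightarrow> real"
    unfolding J_def by (simp add: sum.reindex sum.cartesian_product case_prod_unfold)
  have cone: "(\<Sum>j\<in>J. d j * g j) \<le> 0"
    if d: "\<And>k. k \<in> K \<Longrightarrow> (\<Sum>j\<in>J. d j * c j $ k) \<le> 0" for d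
  proof -
    define D where "D i = (\<chi> t. d (Some (i, t)))" for i
    define z where "z \<eta> i = x i + \<eta> *\<^sub>R D i" for \<eta> i
    have "\<forall>\<^sub>F \<eta> in at_right 0. \<forall>l\<in>UNIV.
        (\<Sum>i\<in>users N. a i l \<bullet> x i) + \<eta> * (\<Sum>i\<in>users N. a i l \<bullet> D i) \<le> b $ l"
    proof (intro eventually_ball_finite ballI eventually_active_le)
      fix l assume "(\<Sum>i\<in>users N. a i l \<bullet> x i) = b $ l"
      then show "(\<Sum>i\<in>users N. a i l \<bullet> D i) \<le> 0"
        using d[of "Inl l"]
        by (simp add: K_def sum_J c_def D_def inner_vec_def mult.commute)
    qed (use x in \<open>auto simp: feasible_set_def\<close>)
    then have feasible: "\<forall>\<^sub>F \<eta> in at_right 0. z \<eta> \<in> feasible_set N a b"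
      by eventually_elim
        (simp add: feasible_set_def z_def inner_add_right sum.distrib sum_distrib_left)
    have "\<forall>\<^sub>F \<eta> in at_right 0. \<forall>t\<in>UNIV.
        X t + \<eta> * ((\<Sum>i\<in>users N. D i $ t) - d None) \<le> w"
    proof (intro eventually_ball_finite ballI eventually_active_le)
      fix t assume "X t = w"
      then show "(\<Sum>i\<in>users N. D i $ t) - d None \<le> 0"
        using d[of "Inr t"]
        by (simp add: K_def sum_J c_def D_def if_distrib cong: if_cong)
    qed (use X_le in auto)
    then have peak: "\<forall>\<^sub>F \<eta> in at_right 0.
        Max (range (\<lambda>t. \<Sum>i\<in>users N. z \<eta> i $ t)) \<le> w + \<eta> * d None"
    proof eventually_elim
      case (elim \<eta>)
      then show ?case
        by (auto simp: z_def X_def sum.distrib sum_distrib_left algebra_simps)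
    qed
    \<comment> \<open>A differentiable lower bound of welfare for small positive steps: the linear
      bound from \<open>peak\<close> replaces the maximum. It equals the welfare of \<open>x\<close>
      at 0, so \<open>f\<close> inherits the maximum there.\<close>
    define f where "f \<eta> = (\<Sum>i\<in>users N. \<Sum>t\<in>UNIV.
        v i t (x i $ t + \<eta> * d (Some (i, t))) - p $ t * (x i $ t + \<eta> * d (Some (i, t))))
        - p0 * (w + \<eta> * d None)" for \<eta>
    have "DERIV f 0 :> (\<Sum>i\<in>users N. \<Sum>t\<in>UNIV. v' i t * d (Some (i, t)) - p $ t * d (Some (i, t)))
        - p0 * d None"
    proof -
      have "((\<lambda>\<eta>. v i t (x i $ t + \<eta> * d (Some (i, t)))) has_real_derivative v' i t * d (Some (i, t)))
          (at 0)" if "i \<in> users N" for i t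
        using v[OF that, of t]
        by (intro DERIV_chain2[of "v i t"]) (auto intro!: derivative_eq_intros)
      then show ?thesis
        unfolding f_def by (auto intro!: derivative_eq_intros sum.cong)
    qed
    moreover have "\<forall>\<^sub>F \<eta> in at_right 0. f \<eta> \<le> f 0"
      using feasible peak
    proof eventually_elim
      case (elim \<eta>)
      have "f \<eta> \<le> welfare N v p p0 (z \<eta>)"
        using mult_left_mono[OF elim(2) \<open>0 \<le> p0\<close>] by (simp add: f_def welfare_def z_def D_def)
      also have "\<dots> \<le> welfare N v p p0 x"
        using elim(1) by (rule max)
      also have "\<dots> = f 0"
        by (simp add: f_def welfare_def w_def X_def[abs_def])
      finally show ?case .
    qed
    ultimately have "(\<Sum>i\<in>users N. \<Sum>t\<in>UNIV. v' i t * d (Some (i, t)) - p $ t * d (Some (i, t)))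
        - p0 * d None \<le> 0"
      by (rule deriv_nonpos_of_right_max)
    then show "(\<Sum>j\<in>J. d j * g j) \<le> 0"
      by (simp add: sum_J g_def algebra_simps)
  qed
  have "finite J"
    by (simp add: J_def)
  then obtain y where y: "\<And>k. 0 \<le> y $ k" "\<And>k. k \<notin> K \<Longrightarrow> y $ k = 0"
      "\<And>j. j \<in> J \<Longrightarrow> g j = y \<bullet> c j"
    using farkas_active[of J K c g, OF _ cone] by metis
  have inner_c: "y \<bullet> c j = (\<Sum>l\<in>UNIV. y $ Inl l * c j $ Inl l) + (\<Sum>t\<in>UNIV. y $ Inr t * c j $ Inr t)" for j
    by (simp add: inner_vec_def sum.Plus flip: UNIV_Plus_UNIV)
  show thesis
  proof (rule that[of "\<chi> l. y $ Inl l" "\<chi> t. y $ Inr t"])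
    \<comment> \<open>Stationarity in the variable \<open>None\<close>: its gain is
      \<open>- p0\<close> and its coefficient is \<open>- 1\<close> on every peak row.\<close>
    show "(\<Sum>t\<in>UNIV. (\<chi> t. y $ Inr t) $ t) = p0"
      using y(3)[of None] inner_c[of None] by (simp add: J_def g_def c_def sum_negf)
    show "(\<chi> l. y $ Inl l) $ l * (b $ l - (\<Sum>j\<in>users N. a j l \<bullet> x j)) = 0" for l
      using y(2)[of "Inl l"] by (auto simp: K_def)
    show "(\<chi> t. y $ Inr t) $ t * (Max (range (($) (\<Sum>j\<in>users N. x j))) - (\<Sum>j\<in>users N. x j) $ t) = 0" for t
    proof -
      have "($) (\<Sum>j\<in>users N. x j) = X"
        by (auto simp: X_def)
      then show ?thesis
        using y(2)[of "Inr t"] by (auto simp: K_def w_def)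
    qed
    show "v' i t = p $ t + (\<chi> t. y $ Inr t) $ t + (\<Sum>l\<in>UNIV. (\<chi> l. y $ Inl l) $ l * a i l $ t)"
      if "i \<in> users N" for i t
      using y(3)[of "Some (i, t)"] inner_c[of "Some (i, t)"] that
      by (simp add: J_def g_def c_def if_distrib cong: if_cong)
  qed (use y(1) in simp_all)
qed

section \<open>Combining maximiser, multipliers and best responses\<close>

theorem theorem2:
  fixes N :: nat
    and v :: "nat \<Rightarrow> 't::finite \<Rightarrow> real \<Rightarrow> real"
    and p :: "real^'t"
    and p0 :: real
    and a :: "nat \<Rightarrow> 'l::finite \<Rightarrow> real^'t"
    and b :: "real^'l"
  assumes "N \<ge> 2"
    and "p0 \<ge> 0"
    and "\<And>i t. i \<in> users N \<Longrightarrow> twice_differentiable (v i t)"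
    and "\<And>i t. i \<in> users N \<Longrightarrow> strictly_concave (v i t)"
    and "\<And>l. 0 \<le> b $ l"
    and "bounded_demands N (feasible_set N a b)"
    and "coordinate_convex (feasible_set N a b)"
  shows "\<exists>m :: nat \<Rightarrow> ('t, 'l) message.
           nash_equilibrium (users N) (\<lambda>_. messages) (payoff N v p p0 a b) m"
proof -
  have deriv: "DERIV (v i t) y :> deriv (v i t) y" if "i \<in> users N" for i t y
    using assms(3)[OF that] unfolding twice_differentiable_def
    by (metis DERIV_deriv_iff_real_differentiable)
  then have cont: "continuous_on UNIV (v i t)" if "i \<in> users N" for i t
    using that by (meson DERIV_continuous_on has_field_derivative_at_within)
  obtain x where x: "x \<in> feasible_set N a b"
    and max: "\<And>y. y \<in> feasible_set N a b \<Longrightarrow> welfare N v p p0 y \<le> welfare N v p p0 x"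
    using ex_maximal_demand[where v = v and p = p and ?p0.0 = p0, OF cont assms(5,6)] by blast
  obtain \<kappa> \<mu> where kkt: "\<And>l. 0 \<le> \<kappa> $ l" "\<And>t. 0 \<le> \<mu> $ t" "(\<Sum>t\<in>UNIV. \<mu> $ t) = p0"
      "\<And>l. \<kappa> $ l * (b $ l - (\<Sum>j\<in>users N. a j l \<bullet> x j)) = 0"
      "\<And>t. \<mu> $ t * (Max (range (($) (\<Sum>j\<in>users N. x j))) - (\<Sum>j\<in>users N. x j) $ t) = 0"
    and stat: "\<And>i t. i \<in> users N \<Longrightarrow>
      deriv (v i t) (x i $ t) = p $ t + \<mu> $ t + (\<Sum>l\<in>UNIV. \<kappa> $ l * a i l $ t)"
    using ex_kkt_multipliers[where v = v and x = x and v' = "\<lambda>i t. deriv (v i t) (x i $ t)" and p = p,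
        OF deriv assms(2) x max]
    by blast
  \<comment> \<open>By \<open>stat\<close> the slope at \<open>x i $ t\<close> is the price the user
    faces, so the tangent inequality is the claim.\<close>
  have "v i t y - (p $ t + \<mu> $ t + (\<Sum>l\<in>UNIV. \<kappa> $ l * a i l $ t)) * y
      \<le> v i t (x i $ t) - (p $ t + \<mu> $ t + (\<Sum>l\<in>UNIV. \<kappa> $ l * a i l $ t)) * x i $ t"
    if "i \<in> users N" for i t y
    using strictly_concave_le_tangent[OF assms(4)[OF that] deriv[OF that], of t y "x i $ t"]
    by (simp add: stat[OF that] right_diff_distrib)
  from nash_equilibrium_kkt_messages[OF assms(1) kkt(1-3) x kkt(4,5) this] show ?thesis
    by blast
qed

end
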